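(* Consider one point target with complex reflectivity $\rho_0\neq0$ at $\boldsymbol{y}_0=(x_0,y_0,0)$ and the signal subspace image $1/F_\epsilon(\boldsymbol{y})$ defined in the context, in which the travel time differences are randomly perturbed: $$\varDelta\tau_n=\varDelta\tau_n^0+\nu_n,\qquad n=1,\dots,N,$$ where $\varDelta\tau_n^0$ is the difference in travel times for a homogeneous medium and $\boldsymbol{\nu}=(\nu_1,\dots,\nu_N)$ is a random vector with $\mathbb{E}[\nu_n]=0$ and $\mathbb{E}[\nu_n^2]=\sigma_n^2$. Let $\sigma^2=\max\{\sigma_1^2,\dots,\sigma_N^2\}$. Assume that the signal-to-noise ratio is sufficiently high that the singular values corresponding to the signal subspace can be distinguished from those corresponding to the noise subspace, and that $\sigma^2/\epsilon\ll1$. Then, in a neighborhood about $\boldsymbol{y}=\boldsymbol{y}_0$, the image $1/F_\epsilon(\boldsymbol{y})$ has an expected value whose leading behavior is the result for the homogeneous medium, plus a term that is $O(\sigma^2/\epsilon)$, i.e. $$\mathbb{E}\!\left[\frac1{F_\epsilon(\boldsymbol{y})}\right]=\frac{1}{F_\epsilon^{0}(\boldsymbol{y})}+O\!\left(\frac{\sigma^2}{\epsilon}\right),$$ where $F^0_\epsilon$ denotes the functional $F_\epsilon$ in the homogeneous medium (all $\nu_n=0$), and it has a variance $$\mathrm{Var}\!\left[\frac1{F_\epsilon(\boldsymbol{y})}\right]=O\!\left(\frac{\sigma^2}{\epsilon}\right).$$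
   Context: Geometry. The imaging region is planar, contained in $\{z=0\}$, with the origin at its center; $\boldsymbol{y}=(x,y,0)$ is the search location. The measurement positions on the linear flight path are $\boldsymbol{x}_n=(x_n,R,H)$, $x_n=-a/2+a(n-1)/(N-1)$, $n=1,\dots,N$, with $a,R,H>0$, $N\ge2$; $L=\sqrt{R^2+H^2}$ is assumed to be the largest length scale in the problem. $c>0$ is the wave speed. Frequencies. Let $M\ge2$. The data are sampled at equally spaced angular frequencies $\omega_m=\omega_1+(m-1)\Delta\omega$, $m=1,\dots,2M-1$. With bandwidth $B>0$ and central angular frequency $\omega_0$, the frequencies $\omega_1,\dots,\omega_M$ are $\omega_m=\omega_0\left[1+\beta\left(\frac{m-1}{M-1}-\frac12\right)\right]$, $\beta=2\pi B/\omega_0$. Imaging functional. From the measurements $d_n(\omega_m)$ form the $M\times M$ Prony matrices $(D_n)_{jk}=d_n(\omega_{j+k-1})$, with singular value decompositions $D_n=U_n\Sigma_nV_n^*$. For one point target in the homogeneous medium, the Born approximation gives $d_n(\omega_m)=\rho_0e^{2\mathrm{i}\omega_m|\boldsymbol{x}_n-\boldsymbol{y}_0|/c}/(4\pi|\boldsymbol{x}_n-\boldsymbol{y}_0|)^2$, so that $D_n$ has rank one with singular value $\sigma_0^{(n)}=M|\rho_0|/(4\pi|\boldsymbol{x}_n-\boldsymbol{y}_0|)^2$; the first singular value corresponds to the signal subspace, the remaining ones to the noise subspace. For a user-defined parameter $0<\epsilon<1$ set $\Sigma_n^+=\frac1{\sigma_0^{(n)}}\mathrm{diag}(1,1/\epsilon,\dots,1/\epsilon)$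 and $$F_\epsilon(\boldsymbol{y})=\frac1N\sum_{n=1}^N\mathbf{a}_n^*(\boldsymbol{y})U_n\Sigma_n^+U_n^*\mathbf{a}_n(\boldsymbol{y}),\qquad \mathbf{a}_n(\boldsymbol{y})=\frac{1}{4\pi|\boldsymbol{x}_n-\boldsymbol{y}|}\left(e^{2\mathrm{i}\omega_m|\boldsymbol{x}_n-\boldsymbol{y}|/c}\right)_{m=1}^M .$$ The dependence of $F_\epsilon$ on the travel time differences is $$F_\epsilon(\boldsymbol{y})=\frac1{|\rho_0|}\frac1N\sum_{n=1}^N\left(\frac1\epsilon-\left(\frac1\epsilon-1\right)|\Phi_n|^2\right)\frac{|\boldsymbol{x}_n-\boldsymbol{y}_0|^2}{|\boldsymbol{x}_n-\boldsymbol{y}|^2},\qquad \Phi_n=\frac1M\sum_{m=1}^Me^{\mathrm{i}\omega_m\varDelta\tau_n},$$ where $\varDelta\tau_n$ is the difference in travel times for the search and target locations; in the homogeneous medium it equals $\varDelta\tau_n^0=2(|\boldsymbol{x}_n-\boldsymbol{y}|-|\boldsymbol{x}_n-\boldsymbol{y}_0|)/c$. With travel time uncertainty, $F_\epsilon$ is the same expression with $\varDelta\tau_n=\varDelta\tau_n^0+\nu_n$. *)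

theory Defs
  imports "HOL-Probability.Probability" "Jordan_Normal_Form.Schur_Decomposition"
begin

(* $ is indexing of Jordan_Normal_Form vectors here. *)
unbundle no vec_syntax

type_synonym point = "real \<times> real \<times> real"

definition flight_position :: "real \<Rightarrow> real \<Rightarrow> real \<Rightarrow> nat \<Rightarrow> nat \<Rightarrow> point" where
  "flight_position a R H N n = (- a / 2 + a * (real n - 1) / (real N - 1), R, H)"

(* The formula for m = 1..M, extended to every m; it is affine in m, so that it also gives
   the remaining equally spaced samples m = M+1..2M-1. *)
definition frequency :: "real \<Rightarrow> real \<Rightarrow> nat \<Rightarrow> nat \<Rightarrow> real" where
  "frequency \<omega>0 B M m =
     (let \<beta> = 2 * pi * B / \<omega>0 in \<omega>0 * (1 + \<beta> * ((real m - 1) / (real M - 1) - 1 / 2)))"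

definition travel_time :: "real \<Rightarrow> point \<Rightarrow> point \<Rightarrow> real" where
  "travel_time c x y = 2 * dist x y / c"

(* Born data at receiver x of a target at y0, when the round trip travel time to the target
   is \<tau>.  In the homogeneous medium \<tau> = travel_time c x y0; since the image compares with the
   homogeneous travel time to the search point, \<tau> = travel_time c x y0 - \<nu> perturbs the
   travel time difference by + \<nu> (see F_image_closed_form). *)
definition born_data :: "(nat \<Rightarrow> real) \<Rightarrow> complex \<Rightarrow> point \<Rightarrow> point \<Rightarrow> real \<Rightarrow> nat \<Rightarrow> complex" where
  "born_data \<omega> \<rho>0 y0 x \<tau> m = \<rho>0 * exp (\<i> * of_real (\<omega> m * \<tau>)) / of_real ((4 * pi * dist x y0)\<^sup>2)"

(* Rows and columns are counted from 0 in type mat, samples from 1. *)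
definition prony_matrix :: "nat \<Rightarrow> (nat \<Rightarrow> complex) \<Rightarrow> complex mat" where
  "prony_matrix M d = mat M M (\<lambda>(j, k). d (j + k + 1))"

definition unitary_mat :: "nat \<Rightarrow> complex mat \<Rightarrow> bool" where
  "unitary_mat M U \<longleftrightarrow> U \<in> carrier_mat M M \<and> mat_adjoint U * U = 1\<^sub>m M"

definition is_svd :: "nat \<Rightarrow> complex mat \<Rightarrow> complex mat \<Rightarrow> (nat \<Rightarrow> real) \<Rightarrow> complex mat \<Rightarrow> bool" where
  "is_svd M D U s V \<longleftrightarrow>
     unitary_mat M U \<and> unitary_mat M V \<and>
     (\<forall>j<M. 0 \<le> s j) \<and> (\<forall>j k. j \<le> k \<and> k < M \<longrightarrow> s k \<le> s j) \<and>
     D = U * mat_diag M (\<lambda>j. of_real (s j)) * mat_adjoint V"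

(* The signal subspace is spanned by the first singular vector (one point target). *)
definition signal_distinguished :: "nat \<Rightarrow> (nat \<Rightarrow> real) \<Rightarrow> bool" where
  "signal_distinguished M s \<longleftrightarrow> (\<forall>j. 0 < j \<and> j < M \<longrightarrow> s j < s 0)"

definition Sigma_plus :: "nat \<Rightarrow> real \<Rightarrow> real \<Rightarrow> complex mat" where
  "Sigma_plus M \<epsilon> \<sigma>0 = mat_diag M (\<lambda>j. of_real (1 / \<sigma>0 * (if j = 0 then 1 else 1 / \<epsilon>)))"

definition illumination :: "nat \<Rightarrow> (nat \<Rightarrow> real) \<Rightarrow> real \<Rightarrow> point \<Rightarrow> point \<Rightarrow> complex vec" where
  "illumination M \<omega> c x y =
     vec M (\<lambda>j. exp (\<i> * of_real (\<omega> (j + 1) * travel_time c x y)) / of_real (4 * pi * dist x y))"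

(* U n and s n are the left singular vectors and the singular values of the n-th Prony matrix.
   The quadratic form is Hermitian, so that Re only changes the type. *)
definition F_image ::
  "nat \<Rightarrow> nat \<Rightarrow> (nat \<Rightarrow> real) \<Rightarrow> real \<Rightarrow> (nat \<Rightarrow> point) \<Rightarrow> real \<Rightarrow>
   (nat \<Rightarrow> complex mat) \<Rightarrow> (nat \<Rightarrow> nat \<Rightarrow> real) \<Rightarrow> point \<Rightarrow> real" where
  "F_image N M \<omega> c x \<epsilon> U s y =
     1 / real N * (\<Sum>n = 1..N.
       (let a = illumination M \<omega> c (x n) y in
        Re (((U n * Sigma_plus M \<epsilon> (s n 0) * mat_adjoint (U n)) *\<^sub>v a) \<bullet>c a)))"

definition Phi :: "nat \<Rightarrow> (nat \<Rightarrow> real) \<Rightarrow> real \<Rightarrow> complex" where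
  "Phi M \<omega> t = 1 / of_nat M * (\<Sum>m = 1..M. exp (\<i> * of_real (\<omega> m * t)))"

lemma mat_adjoint_index:
  assumes "A \<in> carrier_mat m n" "i < n" "j < m"
  shows "mat_adjoint A $$ (i, j) = cnj (A $$ (j, i))"
  using assms by (auto simp: mat_adjoint_def mat_of_rows_def)

lemma mat_adjoint_carrier:
  assumes "A \<in> carrier_mat m n"
  shows "mat_adjoint A \<in> carrier_mat n m"
  using assms by (auto simp: mat_adjoint_def mat_of_rows_def)

lemma unitary_columns:
  assumes "unitary_mat M U" "j < M" "k < M"
  shows "(\<Sum>i<M. cnj (U $$ (i, j)) * U $$ (i, k)) = (if j = k then 1 else 0)"
proof -
  have U: "U \<in> carrier_mat M M" and e: "mat_adjoint U * U = 1\<^sub>m M"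
    using assms(1) by (auto simp: unitary_mat_def)
  note A = mat_adjoint_carrier[OF U]
  have "(mat_adjoint U * U) $$ (j, k) = (\<Sum>i<M. cnj (U $$ (i, j)) * U $$ (i, k))"
    using U A assms(2,3)
    by (auto simp: scalar_prod_def mat_adjoint_index[OF U] lessThan_atLeast0 intro!: sum.cong)
  then show ?thesis using e assms(2,3) by auto
qed

lemma unitary_rows:
  assumes "unitary_mat M U" "j < M" "k < M"
  shows "(\<Sum>i<M. U $$ (j, i) * cnj (U $$ (k, i))) = (if j = k then 1 else 0)"
proof -
  have U: "U \<in> carrier_mat M M" and e: "mat_adjoint U * U = 1\<^sub>m M"
    using assms(1) by (auto simp: unitary_mat_def)
  note A = mat_adjoint_carrier[OF U]
  have e': "U * mat_adjoint U = 1\<^sub>m M"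
    using mat_mult_left_right_inverse[OF A U e] .
  have "(U * mat_adjoint U) $$ (j, k) = (\<Sum>i<M. U $$ (j, i) * cnj (U $$ (k, i)))"
    using U A assms(2,3)
    by (auto simp: scalar_prod_def mat_adjoint_index[OF U] lessThan_atLeast0 intro!: sum.cong)
  then show ?thesis using e' assms(2,3) by auto
qed

lemma diag_sandwich:
  assumes U: "U \<in> carrier_mat M M" and V: "V \<in> carrier_mat M M" and "j < M" "k < M"
  shows "(U * mat_diag M f * mat_adjoint V) $$ (j, k) = (\<Sum>i<M. U $$ (j, i) * f i * cnj (V $$ (k, i)))"
  using assms mat_adjoint_carrier[OF V]
  by (auto simp: mat_diag_mult_right[OF U] scalar_prod_def mat_adjoint_index[OF V]
      lessThan_atLeast0 intro!: sum.cong)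

lemma quadratic_form:
  fixes f :: "nat \<Rightarrow> complex"
  assumes U: "U \<in> carrier_mat M M" and a: "a \<in> carrier_vec M"
  shows "((U * mat_diag M f * mat_adjoint U) *\<^sub>v a) \<bullet>c a =
    (\<Sum>i<M. f i * of_real ((cmod (\<Sum>j<M. cnj (U $$ (j, i)) * a $ j))\<^sup>2))"
proof -
  let ?A = "U * mat_diag M f * mat_adjoint U"
  have A: "?A \<in> carrier_mat M M"
    using U mat_adjoint_carrier[OF U] by (meson mat_diag_dim mult_carrier_mat)
  have "(?A *\<^sub>v a) \<bullet>c a = (\<Sum>j<M. (\<Sum>k<M. ?A $$ (j, k) * a $ k) * cnj (a $ j))"
  proof -
    have "(?A *\<^sub>v a) $ j = (\<Sum>k<M. ?A $$ (j, k) * a $ k)" if "j < M" for j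
      using A a that by (auto simp: scalar_prod_def lessThan_atLeast0 simp del: index_mult_mat)
    thus ?thesis using A a by (simp add: scalar_prod_def lessThan_atLeast0)
  qed
  also have "\<dots> = (\<Sum>j<M. (\<Sum>k<M. (\<Sum>i<M. U $$ (j, i) * f i * cnj (U $$ (k, i))) * a $ k) * cnj (a $ j))"
    by (intro sum.cong refl arg_cong2[where f="(*)"] diag_sandwich U) auto
  also have "\<dots> = (\<Sum>j<M. \<Sum>k<M. \<Sum>i<M. U $$ (j, i) * f i * cnj (U $$ (k, i)) * a $ k * cnj (a $ j))"
    by (simp add: sum_distrib_right)
  also have "\<dots> = (\<Sum>j<M. \<Sum>i<M. \<Sum>k<M. U $$ (j, i) * f i * cnj (U $$ (k, i)) * a $ k * cnj (a $ j))"
    by (intro sum.cong refl sum.swap)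
  also have "\<dots> = (\<Sum>i<M. \<Sum>j<M. \<Sum>k<M. U $$ (j, i) * f i * cnj (U $$ (k, i)) * a $ k * cnj (a $ j))"
    by (rule sum.swap)
  also have "\<dots> = (\<Sum>i<M. f i * of_real ((cmod (\<Sum>j<M. cnj (U $$ (j, i)) * a $ j))\<^sup>2))"
  proof (intro sum.cong refl)
    fix i
    have "(\<Sum>j<M. \<Sum>k<M. U $$ (j, i) * f i * cnj (U $$ (k, i)) * a $ k * cnj (a $ j))
      = f i * ((\<Sum>j<M. cnj (U $$ (j, i)) * a $ j) * cnj (\<Sum>j<M. cnj (U $$ (j, i)) * a $ j))"
      by (simp add: sum_product sum_distrib_left cnj_sum algebra_simps)
    then show "(\<Sum>j<M. \<Sum>k<M. U $$ (j, i) * f i * cnj (U $$ (k, i)) * a $ k * cnj (a $ j))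
      = f i * of_real ((cmod (\<Sum>j<M. cnj (U $$ (j, i)) * a $ j))\<^sup>2)"
      by (simp only: complex_norm_square)
  qed
  finally show ?thesis .
qed

lemma rank_one_svd:
  assumes svd: "is_svd M D U s V" and pos: "0 < s 0" and M: "0 < M"
    and D: "\<And>j k. j < M \<Longrightarrow> k < M \<Longrightarrow> D $$ (j, k) = \<kappa> * e j * e k"
    and e: "\<And>j. j < M \<Longrightarrow> cmod (e j) = 1"
  obtains \<alpha> where "\<And>j. j < M \<Longrightarrow> U $$ (j, 0) = \<alpha> * e j" "(cmod \<alpha>)\<^sup>2 = 1 / M"
    and "s 0 = M * cmod \<kappa>"
proof -
  have U: "unitary_mat M U" "U \<in> carrier_mat M M" and V: "unitary_mat M V" "V \<in> carrier_mat M M"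
    and DD: "D = U * mat_diag M (\<lambda>j. of_real (s j)) * mat_adjoint V"
    and s0: "\<And>j. j < M \<Longrightarrow> 0 \<le> s j"
    using svd by (auto simp: is_svd_def unitary_mat_def)
  have Dent: "\<kappa> * e j * e k = (\<Sum>i<M. U $$ (j, i) * of_real (s i) * cnj (V $$ (k, i)))"
    if "j < M" "k < M" for j k
    using D[OF that] diag_sandwich[OF U(2) V(2) that] DD by metis
  have col: "of_real (s l) * U $$ (j, l) = \<kappa> * (\<Sum>k<M. e k * V $$ (k, l)) * e j"
    if "j < M" "l < M" for j l
  proof -
    have "\<kappa> * (\<Sum>k<M. e k * V $$ (k, l)) * e j = (\<Sum>k<M. (\<kappa> * e j * e k) * V $$ (k, l))"
      by (simp add: sum_distrib_left sum_distrib_right algebra_simps)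
    also have "\<dots> = (\<Sum>k<M. (\<Sum>i<M. U $$ (j, i) * of_real (s i) * cnj (V $$ (k, i))) * V $$ (k, l))"
      by (intro sum.cong refl) (simp add: Dent that)
    also have "\<dots> = (\<Sum>i<M. U $$ (j, i) * of_real (s i) * (\<Sum>k<M. cnj (V $$ (k, i)) * V $$ (k, l)))"
      by (simp add: sum_distrib_left sum_distrib_right mult.assoc) (rule sum.swap)
    also have "\<dots> = (\<Sum>i<M. U $$ (j, i) * of_real (s i) * (if i = l then 1 else 0))"
      by (intro sum.cong refl) (simp add: unitary_columns[OF V(1)] that)
    also have "\<dots> = of_real (s l) * U $$ (j, l)"
      using that by (simp add: if_distrib sum.delta cong: if_cong)
    finally show ?thesis by simp
  qed
  define \<alpha> where "\<alpha> = \<kappa> * (\<Sum>k<M. e k * V $$ (k, 0)) / of_real (s 0)"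
  have U0: "U $$ (j, 0) = \<alpha> * e j" if "j < M" for j
    using col[OF that M] pos by (simp add: \<alpha>_def field_simps)
  have "(1::complex) = (\<Sum>i<M. cnj (U $$ (i, 0)) * U $$ (i, 0))"
    using unitary_columns[OF U(1) M M] by simp
  also have "\<dots> = (\<Sum>i<M. of_real ((cmod \<alpha>)\<^sup>2))"
  proof (intro sum.cong refl)
    fix i assume i: "i \<in> {..<M}"
    have "cnj (U $$ (i, 0)) * U $$ (i, 0) = of_real ((cmod (\<alpha> * e i))\<^sup>2)"
      using U0 i by (simp only: complex_norm_square mult.commute lessThan_iff)
    thus "cnj (U $$ (i, 0)) * U $$ (i, 0) = of_real ((cmod \<alpha>)\<^sup>2)"
      using e i by (simp add: norm_mult)
  qed
  also have "\<dots> = of_real (M * (cmod \<alpha>)\<^sup>2)" by simp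
  finally have "M * (cmod \<alpha>)\<^sup>2 = 1" using of_real_eq_1_iff by metis
  hence \<alpha>: "(cmod \<alpha>)\<^sup>2 = 1 / M" using M by (simp add: field_simps)
  hence \<alpha>0: "\<alpha> \<noteq> 0" using M by auto
  have sl: "s l = 0" if l: "0 < l" "l < M" for l
  proof -
    define b where "b = \<kappa> * (\<Sum>k<M. e k * V $$ (k, l))"
    have "0 = of_real (s l) * (\<Sum>i<M. cnj (U $$ (i, 0)) * U $$ (i, l))"
      using unitary_columns[OF U(1) M l(2)] l by simp
    also have "\<dots> = (\<Sum>i<M. cnj (U $$ (i, 0)) * (of_real (s l) * U $$ (i, l)))"
      by (simp add: sum_distrib_left algebra_simps)
    also have "\<dots> = (\<Sum>i<M. cnj \<alpha> * b * (cnj (e i) * e i))"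
      by (intro sum.cong refl) (simp add: col[OF _ l(2)] U0 b_def)
    also have "\<dots> = (\<Sum>i<M. cnj \<alpha> * b)"
      using e by (intro sum.cong refl) (simp add: mult.commute[of "cnj _"] complex_norm_square[symmetric])
    finally have "b = 0" using \<alpha>0 M by simp
    hence z: "of_real (s l) * U $$ (i, l) = 0" if "i < M" for i
      using col[OF that l(2)] by (simp add: b_def)
    have "of_real (s l) * of_real (s l) = (\<Sum>i<M. cnj (of_real (s l) * U $$ (i, l)) * (of_real (s l) * U $$ (i, l)))"
      using unitary_columns[OF U(1) l(2) l(2)]
      by (simp add: algebra_simps flip: sum_distrib_left)
    also have "\<dots> = 0" using z by (intro sum.neutral) auto
    finally show ?thesis by simp
  qed
  have Dent0: "\<kappa> * e j * e k = U $$ (j, 0) * of_real (s 0) * cnj (V $$ (k, 0))"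
    if "j < M" "k < M" for j k
  proof -
    have "(\<Sum>i<M. U $$ (j, i) * of_real (s i) * cnj (V $$ (k, i)))
       = (\<Sum>i<M. if i = 0 then U $$ (j, 0) * of_real (s 0) * cnj (V $$ (k, 0)) else 0)"
      by (intro sum.cong refl) (auto simp: sl)
    thus ?thesis using Dent[OF that] M by simp
  qed
  have "(cmod \<kappa>)\<^sup>2 = (s 0)\<^sup>2 / M * (cmod (V $$ (k, 0)))\<^sup>2" if "k < M" for k
  proof -
    have "cmod (\<kappa> * e 0 * e k) = cmod (U $$ (0, 0) * of_real (s 0) * cnj (V $$ (k, 0)))"
      using Dent0[OF M that] by simp
    hence "cmod \<kappa> = cmod \<alpha> * s 0 * cmod (V $$ (k, 0))"
      using pos M that by (simp add: norm_mult e U0)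
    thus ?thesis using \<alpha> by (simp add: power_mult_distrib)
  qed
  hence "(\<Sum>k<M. (cmod \<kappa>)\<^sup>2) = (\<Sum>k<M. (s 0)\<^sup>2 / M * (cmod (V $$ (k, 0)))\<^sup>2)"
    by (intro sum.cong) auto
  moreover have "(\<Sum>k<M. (cmod (V $$ (k, 0)))\<^sup>2) = 1"
  proof -
    have "complex_of_real (\<Sum>k<M. (cmod (V $$ (k, 0)))\<^sup>2) = 1"
      using unitary_columns[OF V(1) M M] by (simp add: complex_norm_square mult.commute del: of_real_power)
    thus ?thesis using of_real_eq_1_iff by blast
  qed
  ultimately have "M * (cmod \<kappa>)\<^sup>2 = (s 0)\<^sup>2 / M" by (simp only: flip: sum_distrib_left) simp
  hence "(s 0)\<^sup>2 = (M * cmod \<kappa>)\<^sup>2" using M by (simp add: field_simps power2_eq_square)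
  hence "s 0 = M * cmod \<kappa>" using pos by (simp add: power2_eq_iff_nonneg)
  with that U0 \<alpha> show ?thesis by blast
qed

(* What the perturbed travel time in the data amounts to: F_image depends on it through the
   travel time difference 2 (|x n - y| - |x n - y0|) / c + \<nu> n only. *)
lemma F_image_closed_form:
  fixes \<nu> :: "nat \<Rightarrow> real" and x :: "nat \<Rightarrow> point" and c :: real and y0 :: point
  defines "\<tau> \<equiv> \<lambda>n. travel_time c (x n) y0 - \<nu> n"
  assumes M: "M \<ge> 2" and rho: "\<rho>0 \<noteq> 0" and \<epsilon>: "0 < \<epsilon>"
    and freq: "\<omega> = frequency \<omega>0 B M"
    and off: "\<And>n. n \<in> {1..N} \<Longrightarrow> x n \<noteq> y0" "\<And>n. n \<in> {1..N} \<Longrightarrow> x n \<noteq> y"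
    and svd: "\<And>n. n \<in> {1..N} \<Longrightarrow>
      is_svd M (prony_matrix M (born_data \<omega> \<rho>0 y0 (x n) (\<tau> n))) (U n) (s n) (V n)"
    and sig: "\<And>n. n \<in> {1..N} \<Longrightarrow> signal_distinguished M (s n)"
  shows "F_image N M \<omega> c x \<epsilon> U s y =
    1 / cmod \<rho>0 * (1 / real N) * (\<Sum>n = 1..N.
      (1 / \<epsilon> - (1 / \<epsilon> - 1) *
        (cmod (Phi M \<omega> (2 * (dist (x n) y - dist (x n) y0) / c + \<nu> n)))\<^sup>2)
      * ((dist (x n) y0)\<^sup>2 / (dist (x n) y)\<^sup>2))"
proof -
  define b h where "b = 2 * pi * B / \<omega>0" and "h = inverse (real M - 1)"
  have w: "\<omega> m = \<omega>0 * (1 + b * ((real m - 1) * h - 1 / 2))" for m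
    unfolding freq frequency_def Let_def b_def h_def by (simp only: divide_inverse)
  have equi: "\<omega> m = \<omega> 1 + (real m - 1) * (\<omega>0 * b * h)" for m
    unfolding w[of m] w[of 1] by (simp add: algebra_simps)
  have "Re (((U n * Sigma_plus M \<epsilon> (s n 0) * mat_adjoint (U n)) *\<^sub>v illumination M \<omega> c (x n) y)
            \<bullet>c illumination M \<omega> c (x n) y)
      = 1 / cmod \<rho>0 * ((1 / \<epsilon> - (1 / \<epsilon> - 1) * (cmod (Phi M \<omega> (travel_time c (x n) y - \<tau> n)))\<^sup>2)
      * ((dist (x n) y0)\<^sup>2 / (dist (x n) y)\<^sup>2))" (is "Re (_ \<bullet>c ?a) = _") if n: "n \<in> {1..N}" for n
  proof -
    define r r0 t where "r = dist (x n) y" and "r0 = dist (x n) y0" and "t = travel_time c (x n) y"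
    have r: "r > 0" "r0 > 0" using off n by (auto simp: r_def r0_def)
    have M0: "0 < M" using M by simp
    have Uu: "unitary_mat M (U n)" and U: "U n \<in> carrier_mat M M"
      using svd[OF n] by (auto simp: is_svd_def unitary_mat_def)
    have "0 \<le> s n 1" "s n 1 < s n 0"
      using svd[OF n] sig[OF n] M by (auto simp: is_svd_def signal_distinguished_def)
    hence pos: "0 < s n 0" by simp
    define e where "e = (\<lambda>j. exp (\<i> * of_real (\<omega> (j + 1) * \<tau> n)))"
    define \<kappa> where "\<kappa> = \<rho>0 * exp (- \<i> * of_real (\<omega> 1 * \<tau> n)) / of_real ((4 * pi * r0)\<^sup>2)"
    have e1: "cmod (e j) = 1" for j by (simp add: e_def)
    have ent: "prony_matrix M (born_data \<omega> \<rho>0 y0 (x n) (\<tau> n)) $$ (j, k) = \<kappa> * e j * e k"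
      if "j < M" "k < M" for j k
    proof -
      have *: "\<omega> (j + k + 1) = \<omega> (j + 1) + \<omega> (k + 1) - \<omega> 1"
        by (subst (1 2 3) equi) (simp add: algebra_simps)
      show ?thesis unfolding \<kappa>_def e_def r0_def using that
        by (simp add: prony_matrix_def born_data_def *[simplified] algebra_simps exp_add exp_diff exp_minus field_simps)
    qed
    obtain \<alpha> where \<alpha>: "\<And>j. j < M \<Longrightarrow> U n $$ (j, 0) = \<alpha> * e j" "(cmod \<alpha>)\<^sup>2 = 1 / M"
      and s0: "s n 0 = M * cmod \<kappa>"
      using rank_one_svd[OF svd[OF n] pos M0 ent e1] by blast
    have s0': "s n 0 = M * cmod \<rho>0 / (4 * pi * r0)\<^sup>2"
      using s0 r by (simp add: \<kappa>_def norm_divide norm_mult norm_power power_mult_distrib)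
    have a: "?a \<in> carrier_vec M" by (simp add: illumination_def)
    define q where "q = (\<lambda>i. (cmod (\<Sum>j<M. cnj (U n $$ (j, i)) * ?a $ j))\<^sup>2)"
    have "((U n * Sigma_plus M \<epsilon> (s n 0) * mat_adjoint (U n)) *\<^sub>v ?a) \<bullet>c ?a
       = of_real (\<Sum>i<M. 1 / s n 0 * (if i = 0 then 1 else 1 / \<epsilon>) * q i)"
      unfolding Sigma_plus_def quadratic_form[OF U a] q_def by simp
    hence Q: "Re (((U n * Sigma_plus M \<epsilon> (s n 0) * mat_adjoint (U n)) *\<^sub>v ?a) \<bullet>c ?a)
       = (\<Sum>i<M. 1 / s n 0 * (if i = 0 then 1 else 1 / \<epsilon>) * q i)"
      by (metis Re_complex_of_real)
    also have "\<dots> = 1 / s n 0 * (\<Sum>i<M. 1 / \<epsilon> * q i - (if i = 0 then (1 / \<epsilon> - 1) * q 0 else 0))"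
      unfolding sum_distrib_left by (intro sum.cong refl) (auto simp: algebra_simps diff_divide_distrib)
    also have "\<dots> = 1 / s n 0 * (1 / \<epsilon> * (\<Sum>i<M. q i) - (1 / \<epsilon> - 1) * q 0)"
    proof -
      have "(\<Sum>i<M. if i = 0 then (1 / \<epsilon> - 1) * q 0 else 0) = (1 / \<epsilon> - 1) * q 0"
        using M0 by (subst sum.delta) auto
      thus ?thesis by (simp only: sum_subtractf sum_distrib_left)
    qed
    finally have Q: "Re (((U n * Sigma_plus M \<epsilon> (s n 0) * mat_adjoint (U n)) *\<^sub>v ?a) \<bullet>c ?a)
       = 1 / s n 0 * (1 / \<epsilon> * (\<Sum>i<M. q i) - (1 / \<epsilon> - 1) * q 0)" .
    have anorm: "cmod (?a $ j) = 1 / (4 * pi * r)" if "j < M" for j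
      using that r by (simp add: illumination_def norm_divide norm_mult r_def)
    have q0: "q 0 = M / (4 * pi * r)\<^sup>2 * (cmod (Phi M \<omega> (t - \<tau> n)))\<^sup>2"
    proof -
      have "(\<Sum>j<M. cnj (U n $$ (j, 0)) * ?a $ j) =
         (\<Sum>j<M. cnj \<alpha> / of_real (4 * pi * r) * exp (\<i> * of_real (\<omega> (Suc j) * (t - \<tau> n))))"
        by (intro sum.cong refl)
          (simp add: \<alpha>(1) illumination_def e_def r_def t_def exp_cnj algebra_simps exp_diff exp_minus
             field_simps)
      also have "\<dots> = cnj \<alpha> / of_real (4 * pi * r) * (M * Phi M \<omega> (t - \<tau> n))"
        using M0 by (simp add: Phi_def sum.atLeast1_atMost_eq sum_distrib_left sum_divide_distrib)
      finally have "q 0 = (cmod \<alpha>)\<^sup>2 * (real M)\<^sup>2 / (4 * pi * r)\<^sup>2 * (cmod (Phi M \<omega> (t - \<tau> n)))\<^sup>2"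
        using r by (simp add: q_def norm_mult norm_divide power_mult_distrib power_divide)
      thus ?thesis unfolding \<alpha>(2) using M0 by (simp add: power2_eq_square)
    qed
    have "complex_of_real (\<Sum>i<M. q i) = (\<Sum>i<M. \<Sum>j<M. \<Sum>k<M. (U n $$ (k, i) * cnj (U n $$ (j, i))) * (?a $ j * cnj (?a $ k)))"
      by (simp add: q_def complex_norm_square sum_product algebra_simps del: of_real_power)
        (intro sum.cong refl sum.swap)
    also have "\<dots> = (\<Sum>j<M. \<Sum>i<M. \<Sum>k<M. (U n $$ (k, i) * cnj (U n $$ (j, i))) * (?a $ j * cnj (?a $ k)))"
      by (rule sum.swap)
    also have "\<dots> = (\<Sum>j<M. \<Sum>k<M. \<Sum>i<M. (U n $$ (k, i) * cnj (U n $$ (j, i))) * (?a $ j * cnj (?a $ k)))"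
      by (intro sum.cong refl sum.swap)
    also have "\<dots> = (\<Sum>j<M. \<Sum>k<M. if k = j then ?a $ j * cnj (?a $ k) else 0)"
      by (intro sum.cong refl) (auto simp: unitary_rows[OF Uu] simp flip: sum_distrib_right)
    also have "\<dots> = of_real (\<Sum>j<M. (cmod (?a $ j))\<^sup>2)"
      by (simp add: complex_norm_square del: of_real_power)
    also have "(\<Sum>j<M. (cmod (?a $ j))\<^sup>2) = M / (4 * pi * r)\<^sup>2"
      using anorm by (simp add: power_divide)
    finally have qs: "(\<Sum>i<M. q i) = M / (4 * pi * r)\<^sup>2" using of_real_eq_iff by blast
    show ?thesis unfolding Q unfolding q0 qs s0' unfolding r_def[symmetric] r0_def[symmetric] t_def[symmetric]
      using r M0 rho \<epsilon> by (simp add: field_simps power_mult_distrib)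
  qed
  moreover have "2 * (dist (x n) y - dist (x n) y0) / c + \<nu> n = travel_time c (x n) y - \<tau> n" for n
    by (simp add: travel_time_def \<tau>_def diff_divide_distrib right_diff_distrib)
  ultimately show ?thesis unfolding F_image_def Let_def
    by (simp add: sum_distrib_left mult_ac)
qed

end

theory Submission
  imports Defs
begin

text \<open>
  Write \<open>h = 1 - |\<Phi>|\<^sup>2\<close> and \<open>\<eta> = 1/\<epsilon> - 1\<close>, so that \<open>F\<close> is a sum with positive weights of terms
  \<open>1 + \<eta> h(\<Delta>\<tau>\<^sub>n)\<close>.  Expanding \<open>1/F\<close> to first order in \<open>\<nu>\<close> gives the remainder
  \<open>(F - F\<^sup>0)\<^sup>2 / (F (F\<^sup>0)\<^sup>2)\<close>, which naively is only \<open>O(\<eta>\<^sup>2 \<nu>\<^sup>2)\<close>.  The factor \<open>\<eta>\<close> that is too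
  much is absorbed by the denominator: \<open>h\<close> is an average of functions \<open>1 - cos(\<alpha> t)\<close>, which are
  squares of Lipschitz functions, so \<open>(h(t+\<nu>) - h(t))\<^sup>2 \<le> \<kappa> \<nu>\<^sup>2 (h(t+\<nu>) + h(t))\<close> and therefore
  \<open>(F - F\<^sup>0)\<^sup>2\<close> is bounded by a multiple of \<open>\<eta> (F + F\<^sup>0) |\<nu>|\<^sup>2\<close>.  The bounds are quadratic in \<open>\<nu>\<close>
  for all \<open>\<nu>\<close>, not just for small ones, so that second moments suffice.
\<close>

section \<open>Elementary inequalities for cosines and their averages\<close>

text \<open>Cauchy-Schwarz after splitting each weight as \<open>sqrt (w i) * sqrt (w i)\<close>.
  For weights of sum 1 this is Jensen's inequality for the square.\<close>

lemma weighted_sum_squared_le: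
  fixes w x :: "'a \<Rightarrow> real"
  assumes "\<And>i. i \<in> A \<Longrightarrow> 0 \<le> w i"
  shows "(\<Sum>i\<in>A. w i * x i)\<^sup>2 \<le> (\<Sum>i\<in>A. w i) * (\<Sum>i\<in>A. w i * (x i)\<^sup>2)"
proof -
  have "(\<Sum>i\<in>A. w i * x i) = (\<Sum>i\<in>A. sqrt (w i) * (sqrt (w i) * x i))"
    using assms by (intro sum.cong refl) (simp add: mult.assoc[symmetric])
  also have "\<dots>\<^sup>2 \<le> (\<Sum>i\<in>A. (sqrt (w i))\<^sup>2) * (\<Sum>i\<in>A. (sqrt (w i) * x i)\<^sup>2)"
    by (rule Cauchy_Schwarz_ineq_sum)
  also have "\<dots> = (\<Sum>i\<in>A. w i) * (\<Sum>i\<in>A. w i * (x i)\<^sup>2)"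
    using assms by (simp add: power_mult_distrib)
  finally show ?thesis .
qed

text \<open>Since \<open>1 - cos a = 2 * (sin (a / 2))^2\<close>, the difference of the cosines is a
  difference of squares. Its factor \<open>p - q\<close> is Lipschitz with constant 1/2, and its
  factor \<open>p + q\<close> is controlled by the two defects \<open>1 - cos\<close>.\<close>

lemma cos_diff_squared_le:
  fixes a b :: real
  shows "(cos a - cos b)\<^sup>2 \<le> (a - b)\<^sup>2 * ((1 - cos a) + (1 - cos b))"
proof -
  define p q where "p = sin (a / 2)" and "q = sin (b / 2)"
  have cos: "cos a = 1 - 2 * p\<^sup>2" "cos b = 1 - 2 * q\<^sup>2"
    using cos_double_sin[of "a / 2"] cos_double_sin[of "b / 2"] by (simp_all add: p_def q_def)
  have "\<bar>p - q\<bar> \<le> \<bar>a - b\<bar> / 2"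
  proof -
    have "\<bar>p - q\<bar> = 2 * (\<bar>sin ((a / 2 - b / 2) / 2)\<bar> * \<bar>cos ((a / 2 + b / 2) / 2)\<bar>)"
      by (simp add: p_def q_def sin_diff_sin abs_mult)
    also have "\<dots> \<le> 2 * (\<bar>(a / 2 - b / 2) / 2\<bar> * 1)"
      by (intro mult_mono abs_sin_x_le_abs_x) auto
    also have "\<dots> = \<bar>(a - b) / 2\<bar>"
      by (simp add: abs_if field_simps)
    finally show ?thesis by simp
  qed
  hence "(p - q)\<^sup>2 \<le> (\<bar>a - b\<bar> / 2)\<^sup>2"
    by (metis abs_ge_zero power2_abs power_mono)
  moreover have "(p + q)\<^sup>2 \<le> 2 * (p\<^sup>2 + q\<^sup>2)"
    using sum_squares_bound[of p q] by (simp add: power2_sum)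
  ultimately have "4 * ((p - q)\<^sup>2 * (p + q)\<^sup>2) \<le> 4 * ((\<bar>a - b\<bar> / 2)\<^sup>2 * (2 * (p\<^sup>2 + q\<^sup>2)))"
    by (intro mult_left_mono mult_mono) auto
  also have "\<dots> = (a - b)\<^sup>2 * ((1 - cos a) + (1 - cos b))"
    unfolding cos by (simp add: power_divide algebra_simps)
  also have "4 * ((p - q)\<^sup>2 * (p + q)\<^sup>2) = (cos a - cos b)\<^sup>2"
    unfolding cos by (simp add: power2_eq_square algebra_simps)
  finally show ?thesis .
qed

text \<open>The addition formula splits the remainder into \<open>cos d - 1\<close> and
  \<open>sin d - d\<close>, each at most \<open>d^2 / 2\<close> in absolute value for every
  \<open>d\<close>.\<close>

lemma cos_taylor_bound:
  fixes a d :: real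
  shows "\<bar>cos (a + d) - cos a + d * sin a\<bar> \<le> d\<^sup>2"
proof -
  have "1 - cos d = 2 * (sin (d / 2))\<^sup>2"
    using cos_double_sin[of "d / 2"] by simp
  moreover have "(sin (d / 2))\<^sup>2 \<le> (d / 2)\<^sup>2"
    using abs_sin_x_le_abs_x[of "d / 2"] by (simp only: abs_le_square_iff)
  ultimately have c: "\<bar>cos d - 1\<bar> \<le> d\<^sup>2 / 2"
    by (simp add: power_divide)
  \<comment> \<open>The sine series has no quadratic term, so its truncation before order 2 is
    already \<open>d\<close>. The cubic error bound would be useless for large
    \<open>d\<close>.\<close>
  have s: "\<bar>sin d - d\<bar> \<le> d\<^sup>2 / 2"
    using Maclaurin_sin_bound[of d 2] by (simp add: sin_coeff_def numeral_2_eq_2)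
  have "cos (a + d) - cos a + d * sin a = cos a * (cos d - 1) - sin a * (sin d - d)"
    by (simp add: cos_add algebra_simps)
  also have "\<bar>\<dots>\<bar> \<le> \<bar>cos a\<bar> * \<bar>cos d - 1\<bar> + \<bar>sin a\<bar> * \<bar>sin d - d\<bar>"
    by (metis abs_mult abs_triangle_ineq4)
  also have "\<dots> \<le> 1 * (d\<^sup>2 / 2) + 1 * (d\<^sup>2 / 2)"
    using c s by (intro add_mono mult_mono) auto
  finally show ?thesis by simp
qed

text \<open>The two bounds for a single cosine survive averaging: the first by the triangle
  inequality, the second by Jensen.\<close>

lemma cos_average_bounds:
  fixes w \<alpha> :: "'a \<Rightarrow> real" and h :: "real \<Rightarrow> real"
  assumes fin: "finite A" and w: "\<And>p. p \<in> A \<Longrightarrow> 0 \<le> w p" and w1: "(\<Sum>p\<in>A. w p) = 1"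
    and h: "\<And>t. h t = (\<Sum>p\<in>A. w p * (1 - cos (\<alpha> p * t)))"
  obtains \<kappa> b where "\<kappa> > 0" "\<And>t v. \<bar>h (t + v) - h t - b t * v\<bar> \<le> \<kappa> * v\<^sup>2"
    "\<And>t v. (h (t + v) - h t)\<^sup>2 \<le> \<kappa> * v\<^sup>2 * (h (t + v) + h t)"
proof -
  \<comment> \<open>The sum dominates every \<open>(\<alpha> p)^2\<close>; the summand 1 keeps
    \<kappa> positive even when all \<open>\<alpha> p\<close> vanish.\<close>
  define \<kappa> where "\<kappa> = 1 + (\<Sum>p\<in>A. (\<alpha> p)\<^sup>2)"
  have \<alpha>: "(\<alpha> p)\<^sup>2 \<le> \<kappa>" if "p \<in> A" for p
    using member_le_sum[OF that, of "\<lambda>p. (\<alpha> p)\<^sup>2"] fin by (simp add: \<kappa>_def)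
  have \<kappa>: "\<kappa> > 0"
    by (simp add: \<kappa>_def add_pos_nonneg sum_nonneg)
  \<comment> \<open>\<open>b\<close> is the derivative of \<open>h\<close>.\<close>
  define b where "b t = (\<Sum>p\<in>A. w p * (\<alpha> p * sin (\<alpha> p * t)))" for t
  have "\<bar>h (t + v) - h t - b t * v\<bar> \<le> \<kappa> * v\<^sup>2" for t v
  proof -
    have "h (t + v) - h t - b t * v
        = - (\<Sum>p\<in>A. w p * (cos (\<alpha> p * t + \<alpha> p * v) - cos (\<alpha> p * t) + \<alpha> p * v * sin (\<alpha> p * t)))"
      unfolding h b_def sum_distrib_right sum_subtractf[symmetric] sum_negf[symmetric]
      by (intro sum.cong refl) (simp add: algebra_simps)
    hence "\<bar>h (t + v) - h t - b t * v\<bar>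
        \<le> (\<Sum>p\<in>A. \<bar>w p * (cos (\<alpha> p * t + \<alpha> p * v) - cos (\<alpha> p * t) + \<alpha> p * v * sin (\<alpha> p * t))\<bar>)"
      by (simp only: abs_minus_cancel sum_abs)
    also have "\<dots> \<le> (\<Sum>p\<in>A. w p * (\<kappa> * v\<^sup>2))"
    proof (intro sum_mono)
      fix p assume p: "p \<in> A"
      have "\<bar>cos (\<alpha> p * t + \<alpha> p * v) - cos (\<alpha> p * t) + \<alpha> p * v * sin (\<alpha> p * t)\<bar> \<le> (\<alpha> p * v)\<^sup>2"
        by (rule cos_taylor_bound)
      also have "\<dots> \<le> \<kappa> * v\<^sup>2"
        using \<alpha>[OF p] by (simp add: power_mult_distrib mult_right_mono)
      finally show "\<bar>w p * (cos (\<alpha> p * t + \<alpha> p * v) - cos (\<alpha> p * t) + \<alpha> p * v * sin (\<alpha> p * t))\<bar>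
          \<le> w p * (\<kappa> * v\<^sup>2)"
        using w[OF p] by (simp add: abs_mult mult_left_mono)
    qed
    also have "\<dots> = \<kappa> * v\<^sup>2"
      using w1 by (simp flip: sum_distrib_right)
    finally show ?thesis .
  qed
  moreover have "(h (t + v) - h t)\<^sup>2 \<le> \<kappa> * v\<^sup>2 * (h (t + v) + h t)" for t v
  proof -
    have "h (t + v) - h t = (\<Sum>p\<in>A. w p * (cos (\<alpha> p * t) - cos (\<alpha> p * (t + v))))"
      unfolding h sum_subtractf[symmetric] by (intro sum.cong refl) (simp add: algebra_simps)
    hence "(h (t + v) - h t)\<^sup>2 \<le> (\<Sum>p\<in>A. w p * (cos (\<alpha> p * t) - cos (\<alpha> p * (t + v)))\<^sup>2)"
      using weighted_sum_squared_le[of A w, OF w, where x = "\<lambda>p. cos (\<alpha> p * t) - cos (\<alpha> p * (t + v))"] w1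
      by simp
    also have "\<dots> \<le> (\<Sum>p\<in>A. w p * (\<kappa> * v\<^sup>2 * ((1 - cos (\<alpha> p * (t + v))) + (1 - cos (\<alpha> p * t)))))"
    proof (intro sum_mono mult_left_mono w)
      fix p assume p: "p \<in> A"
      have "(cos (\<alpha> p * t) - cos (\<alpha> p * (t + v)))\<^sup>2
          \<le> (\<alpha> p * t - \<alpha> p * (t + v))\<^sup>2 * ((1 - cos (\<alpha> p * t)) + (1 - cos (\<alpha> p * (t + v))))"
        by (rule cos_diff_squared_le)
      also have "\<alpha> p * t - \<alpha> p * (t + v) = - (\<alpha> p * v)"
        by (simp add: algebra_simps)
      also have "(- (\<alpha> p * v))\<^sup>2 * ((1 - cos (\<alpha> p * t)) + (1 - cos (\<alpha> p * (t + v))))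
          \<le> \<kappa> * v\<^sup>2 * ((1 - cos (\<alpha> p * (t + v))) + (1 - cos (\<alpha> p * t)))"
        using \<alpha>[OF p] \<kappa> cos_le_one[of "\<alpha> p * t"] cos_le_one[of "\<alpha> p * (t + v)"]
        by (intro mult_mono) (auto simp: power_mult_distrib intro: mult_right_mono simp del: cos_le_one)
      finally show "(cos (\<alpha> p * t) - cos (\<alpha> p * (t + v)))\<^sup>2
          \<le> \<kappa> * v\<^sup>2 * ((1 - cos (\<alpha> p * (t + v))) + (1 - cos (\<alpha> p * t)))" .
    qed
    also have "\<dots> = \<kappa> * v\<^sup>2 * (h (t + v) + h t)"
      unfolding h sum.distrib[symmetric] sum_distrib_left by (intro sum.cong refl) (simp add: algebra_simps)
    finally show ?thesis .
  qed
  ultimately show ?thesis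
    using that \<kappa> by blast
qed

section \<open>The coherence factor \<open>Phi\<close> as an average of cosines\<close>

text \<open>Expanding the squared modulus of a mean of exponentials gives a mean over pairs of
  samples, in which only frequency differences occur. This puts \<open>1 - |Phi|^2\<close> into the
  form that \<open>cos_average_bounds\<close> requires.\<close>

lemma Phi_norm_squared:
  "(cmod (Phi M \<omega> t))\<^sup>2
     = (\<Sum>p\<in>{1..M} \<times> {1..M}. 1 / (real M)\<^sup>2 * cos ((\<omega> (fst p) - \<omega> (snd p)) * t))"
proof -
  have parts: "Re (Phi M \<omega> t) = (\<Sum>m = 1..M. cos (\<omega> m * t)) / real M"
    "Im (Phi M \<omega> t) = (\<Sum>m = 1..M. sin (\<omega> m * t)) / real M"
    by (simp_all add: Phi_def Re_exp Im_exp)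
  have "(\<Sum>m = 1..M. cos (\<omega> m * t))\<^sup>2 + (\<Sum>m = 1..M. sin (\<omega> m * t))\<^sup>2
      = (\<Sum>m = 1..M. \<Sum>l = 1..M. cos ((\<omega> m - \<omega> l) * t))"
    by (simp add: power2_eq_square sum_product cos_diff left_diff_distrib sum.distrib)
  hence "(cmod (Phi M \<omega> t))\<^sup>2 = (\<Sum>m = 1..M. \<Sum>l = 1..M. cos ((\<omega> m - \<omega> l) * t)) / (real M)\<^sup>2"
    by (simp add: cmod_power2 parts power_divide flip: add_divide_distrib)
  thus ?thesis
    by (simp add: sum.cartesian_product split_beta sum_divide_distrib)
qed

lemma Phi_norm_squared_le_1: "M \<ge> 1 \<Longrightarrow> (cmod (Phi M \<omega> t))\<^sup>2 \<le> 1"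
proof -
  assume "M \<ge> 1"
  have "cmod (\<Sum>m = 1..M. exp (\<i> * of_real (\<omega> m * t))) \<le> (\<Sum>m = 1..M. 1)"
    by (rule sum_norm_le) simp
  with \<open>M \<ge> 1\<close> have "cmod (Phi M \<omega> t) \<le> 1"
    by (simp add: Phi_def norm_mult norm_divide field_simps)
  thus ?thesis
    by (simp add: power_le_one)
qed

text \<open>The instance of \<open>cos_average_bounds\<close> with equal weights on all pairs of
  frequencies. Here \<kappa> depends on \<open>M\<close> and \<omega> alone, which later makes the
  constant uniform in the search point, \<epsilon> and the law of \<nu>.\<close>

lemma Phi_bounds:
  assumes M: "M \<ge> 1"
  obtains \<kappa> b where "\<kappa> > 0"
    "\<And>t v. \<bar>(1 - (cmod (Phi M \<omega> (t + v)))\<^sup>2) - (1 - (cmod (Phi M \<omega> t))\<^sup>2) - b t * v\<bar> \<le> \<kappa> * v\<^sup>2"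
    "\<And>t v. ((1 - (cmod (Phi M \<omega> (t + v)))\<^sup>2) - (1 - (cmod (Phi M \<omega> t))\<^sup>2))\<^sup>2
       \<le> \<kappa> * v\<^sup>2 * ((1 - (cmod (Phi M \<omega> (t + v)))\<^sup>2) + (1 - (cmod (Phi M \<omega> t))\<^sup>2))"
proof -
  let ?A = "{1..M} \<times> {1..M}"
  have one: "(\<Sum>p\<in>?A. 1 / (real M)\<^sup>2) = 1"
    using M by (simp add: power2_eq_square)
  have "1 - (cmod (Phi M \<omega> t))\<^sup>2
      = (\<Sum>p\<in>?A. 1 / (real M)\<^sup>2 * (1 - cos ((\<omega> (fst p) - \<omega> (snd p)) * t)))" for t
    by (simp only: Phi_norm_squared right_diff_distrib sum_subtractf mult_1_right one)
  from cos_average_bounds[OF _ _ one this] that show ?thesis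
    by auto
qed

section \<open>Deterministic perturbation of the reciprocal of the functional\<close>

text \<open>The sum added on the left of the first bound cancels the first-order Taylor term of
  \<open>1 / F\<close>, which is negative in the increment of \<open>F\<close>. The bounds use \<mu>
  in place of the total weight, because the weights will depend on the search point.\<close>

lemma reciprocal_perturbation:
  fixes w t v :: "nat \<Rightarrow> real" and h b :: "real \<Rightarrow> real" and \<eta> :: real
  assumes w: "\<And>n. n \<in> A \<Longrightarrow> 0 \<le> w n" and \<mu>: "0 < \<mu>" "\<mu> \<le> (\<Sum>n\<in>A. w n)" and \<eta>: "0 \<le> \<eta>"
    and fin: "finite A" and h: "\<And>t. 0 \<le> h t" and \<kappa>: "\<kappa> > 0"
    and lin: "\<And>t v. \<bar>h (t + v) - h t - b t * v\<bar> \<le> \<kappa> * v\<^sup>2"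
    and lip: "\<And>t v. (h (t + v) - h t)\<^sup>2 \<le> \<kappa> * v\<^sup>2 * (h (t + v) + h t)"
  defines "F0 \<equiv> \<Sum>n\<in>A. w n * (1 + \<eta> * h (t n))"
  defines "F \<equiv> \<Sum>n\<in>A. w n * (1 + \<eta> * h (t n + v n))"
  shows "\<bar>1 / F - 1 / F0 + (\<Sum>n\<in>A. \<eta> * w n * b (t n) / F0\<^sup>2 * v n)\<bar>
      \<le> 3 * \<eta> * \<kappa> / \<mu> * (\<Sum>n\<in>A. (v n)\<^sup>2)"
    and "(1 / F - 1 / F0)\<^sup>2 \<le> 2 * \<eta> * \<kappa> / \<mu>\<^sup>2 * (\<Sum>n\<in>A. (v n)\<^sup>2)"
proof -
  define S Q where "S = (\<Sum>n\<in>A. w n)" and "Q = (\<Sum>n\<in>A. (v n)\<^sup>2)"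
  have S: "0 < S" "\<mu> \<le> S"
    using \<mu> by (simp_all add: S_def)
  \<comment> \<open>Replacing each \<open>(v n)^2\<close> by \<open>Q\<close> lets it leave the
    weighted sums, so that only the total weight \<open>S\<close> remains.\<close>
  have vQ: "(v n)\<^sup>2 \<le> Q" if "n \<in> A" for n
    using member_le_sum[OF that, of "\<lambda>n. (v n)\<^sup>2"] fin by (auto simp: Q_def)
  have Q: "0 \<le> Q"
    by (simp add: Q_def sum_nonneg)
  \<comment> \<open>As \<eta> and \<open>h\<close> are nonnegative, \<open>F\<close> and
    \<open>F0\<close> are bounded below by \<open>S\<close>, however large \<eta> is.\<close>
  have "w n \<le> w n * (1 + \<eta> * h s)" if "n \<in> A" for n s
    using mult_left_mono[of 1 "1 + \<eta> * h s" "w n"] w[OF that] h[of s] \<eta> by simp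
  hence "S \<le> F" "S \<le> F0"
    unfolding S_def F_def F0_def by (auto intro: sum_mono)
  hence pos: "0 < F" "0 < F0" and SF: "S \<le> F" "S \<le> F0"
    using S by auto
  have FF: "F - F0 = \<eta> * (\<Sum>n\<in>A. w n * (h (t n + v n) - h (t n)))"
    unfolding F_def F0_def sum_subtractf[symmetric] sum_distrib_left
    by (intro sum.cong refl) (simp add: algebra_simps)
  \<comment> \<open>Squaring produces \<open>\<eta>^2\<close>, but \<open>lip\<close> leaves a
    factor \<open>h\<close>. One \<eta> joins it, and \<eta> times \<open>h\<close> is part of
    \<open>1 + \<eta> * h\<close>, so the sum is at most \<open>F + F0\<close>.\<close>
  have diff2: "(F - F0)\<^sup>2 \<le> \<eta> * \<kappa> * S * Q * (F + F0)"
  proof -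
    have "(F - F0)\<^sup>2 \<le> \<eta>\<^sup>2 * (S * (\<Sum>n\<in>A. w n * (h (t n + v n) - h (t n))\<^sup>2))"
      unfolding FF power_mult_distrib S_def by (intro mult_left_mono weighted_sum_squared_le w) auto
    also have "\<dots> \<le> \<eta>\<^sup>2 * (S * (\<Sum>n\<in>A. w n * (\<kappa> * Q * (h (t n + v n) + h (t n)))))"
    proof (intro mult_left_mono sum_mono w)
      fix n assume n: "n \<in> A"
      show "(h (t n + v n) - h (t n))\<^sup>2 \<le> \<kappa> * Q * (h (t n + v n) + h (t n))"
        by (rule order.trans[OF lip]) (use vQ[OF n] \<kappa> h in \<open>auto intro!: mult_right_mono mult_left_mono\<close>)
    qed (use S in auto)
    also have "\<dots> = \<eta> * \<kappa> * S * Q * (\<Sum>n\<in>A. w n * (\<eta> * h (t n + v n)) + w n * (\<eta> * h (t n)))"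
      by (simp add: sum_distrib_left power2_eq_square algebra_simps)
    also have "\<dots> \<le> \<eta> * \<kappa> * S * Q * (F + F0)"
      unfolding F_def F0_def sum.distrib[symmetric]
      using \<eta> \<kappa> S Q w by (intro mult_left_mono sum_mono) (auto simp: algebra_simps)
    finally show ?thesis .
  qed
  have inv: "1 / F \<le> 1 / S" "1 / F0 \<le> 1 / S"
    using SF S by (auto intro!: divide_left_mono mult_pos_pos pos)
  have "(1 / F - 1 / F0)\<^sup>2 = (F - F0)\<^sup>2 * (1 / F)\<^sup>2 * (1 / F0)\<^sup>2"
    using pos by (simp add: field_simps power2_eq_square)
  also have "\<dots> \<le> \<eta> * \<kappa> * S * Q * (F + F0) * (1 / F)\<^sup>2 * (1 / F0)\<^sup>2"
    by (intro mult_right_mono diff2) auto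
  \<comment> \<open>Of the four reciprocals, \<open>F + F0\<close> cancels one. The two resulting
    products of three reciprocals, each at most \<open>1 / S\<close>, give the constant 2.\<close>
  also have "\<dots> = \<eta> * \<kappa> * S * Q * (1 / F * (1 / F0 * (1 / F0)) + 1 / F * (1 / F * (1 / F0)))"
    using pos by (simp add: field_simps power2_eq_square)
  also have "\<dots> \<le> \<eta> * \<kappa> * S * Q * (1 / S * (1 / S * (1 / S)) + 1 / S * (1 / S * (1 / S)))"
    using inv pos S \<eta> \<kappa> Q by (intro mult_left_mono add_mono mult_mono) auto
  also have "\<dots> = 2 * \<eta> * \<kappa> * Q * (1 / S\<^sup>2)"
    using S by (simp add: field_simps power2_eq_square)
  also have "\<dots> \<le> 2 * \<eta> * \<kappa> * Q * (1 / \<mu>\<^sup>2)"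
    using S \<mu> \<eta> \<kappa> Q by (intro mult_left_mono divide_left_mono power_mono mult_pos_pos) auto
  finally show "(1 / F - 1 / F0)\<^sup>2 \<le> 2 * \<eta> * \<kappa> / \<mu>\<^sup>2 * (\<Sum>n\<in>A. (v n)\<^sup>2)"
    by (simp add: Q_def)

  \<comment> \<open>The first-order variation of \<open>F\<close> at \<open>t\<close> in direction
    \<open>v\<close>.\<close>
  define l where "l = \<eta> * (\<Sum>n\<in>A. w n * (b (t n) * v n))"
  have first: "\<bar>F - F0 - l\<bar> \<le> \<eta> * \<kappa> * S * Q"
  proof -
    have "F - F0 - l = \<eta> * (\<Sum>n\<in>A. w n * (h (t n + v n) - h (t n) - b (t n) * v n))"
      unfolding FF l_def by (simp add: algebra_simps sum_subtractf)
    also have "\<bar>\<dots>\<bar> \<le> \<eta> * (\<Sum>n\<in>A. \<bar>w n * (h (t n + v n) - h (t n) - b (t n) * v n)\<bar>)"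
      unfolding abs_mult[of \<eta>] abs_of_nonneg[OF \<eta>] by (intro mult_left_mono sum_abs \<eta>)
    also have "\<dots> \<le> \<eta> * (\<Sum>n\<in>A. w n * (\<kappa> * Q))"
    proof (intro mult_left_mono sum_mono \<eta>)
      fix n assume n: "n \<in> A"
      have "\<bar>h (t n + v n) - h (t n) - b (t n) * v n\<bar> \<le> \<kappa> * Q"
        by (rule order.trans[OF lin]) (use vQ[OF n] \<kappa> in auto)
      thus "\<bar>w n * (h (t n + v n) - h (t n) - b (t n) * v n)\<bar> \<le> w n * (\<kappa> * Q)"
        using w[OF n] by (simp add: abs_mult mult_left_mono)
    qed
    also have "\<dots> = \<eta> * \<kappa> * S * Q"
      by (simp add: S_def flip: sum_distrib_right)
    finally show ?thesis .
  qed
  have "(\<Sum>n\<in>A. \<eta> * w n * b (t n) / F0\<^sup>2 * v n) = l * (1 / F0 * (1 / F0))"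
    unfolding l_def sum_distrib_left sum_distrib_right
    by (intro sum.cong refl) (simp add: power2_eq_square)
  \<comment> \<open>The exact expansion
    \<open>1/F - 1/F0 = (F - F0)^2 / (F * F0^2) - (F - F0) / F0^2\<close>: a quadratic remainder,
    and a linear part from which \<open>l\<close> is removed.\<close>
  hence "1 / F - 1 / F0 + (\<Sum>n\<in>A. \<eta> * w n * b (t n) / F0\<^sup>2 * v n)
      = (F - F0)\<^sup>2 * (1 / F * (1 / F0 * (1 / F0))) - (F - F0 - l) * (1 / F0 * (1 / F0))"
    using pos by (simp add: field_simps power2_eq_square)
  also have "\<bar>\<dots>\<bar> \<le> \<bar>(F - F0)\<^sup>2 * (1 / F * (1 / F0 * (1 / F0)))\<bar> + \<bar>(F - F0 - l) * (1 / F0 * (1 / F0))\<bar>"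
    by (rule abs_triangle_ineq4)
  also have "\<dots> = (F - F0)\<^sup>2 * (1 / F * (1 / F0 * (1 / F0))) + \<bar>F - F0 - l\<bar> * (1 / F0 * (1 / F0))"
    using pos by (simp add: abs_mult)
  also have "\<dots> \<le> \<eta> * \<kappa> * S * Q * (F + F0) * (1 / F * (1 / F0 * (1 / F0)))
      + \<eta> * \<kappa> * S * Q * (1 / F0 * (1 / F0))"
    using pos by (intro add_mono mult_right_mono diff2 first) auto
  \<comment> \<open>Two products come from the quadratic remainder and one from the Taylor error of
    \<open>F\<close>; hence the constant 3.\<close>
  also have "\<dots> = \<eta> * \<kappa> * S * Q * (1 / F0 * (1 / F0) + 1 / F * (1 / F0) + 1 / F0 * (1 / F0))"
    using pos by (simp add: field_simps power2_eq_square)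
  also have "\<dots> \<le> \<eta> * \<kappa> * S * Q * (1 / S * (1 / S) + 1 / S * (1 / S) + 1 / S * (1 / S))"
    using inv pos S \<eta> \<kappa> Q by (intro mult_left_mono add_mono mult_mono) auto
  also have "\<dots> = 3 * \<eta> * \<kappa> * Q * (1 / S)"
    using S by (simp add: field_simps)
  also have "\<dots> \<le> 3 * \<eta> * \<kappa> * Q * (1 / \<mu>)"
    using S \<mu> \<eta> \<kappa> Q by (intro mult_left_mono divide_left_mono mult_pos_pos) auto
  finally show "\<bar>1 / F - 1 / F0 + (\<Sum>n\<in>A. \<eta> * w n * b (t n) / F0\<^sup>2 * v n)\<bar>
      \<le> 3 * \<eta> * \<kappa> / \<mu> * (\<Sum>n\<in>A. (v n)\<^sup>2)"
    by (simp add: Q_def)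
qed

section \<open>From pathwise bounds to mean and variance\<close>

context prob_space
begin

text \<open>The right side exceeds the variance by the squared bias
  \<open>(expectation X - m)^2\<close>. This allows centring at the homogeneous value instead of the
  unknown mean.\<close>

lemma variance_le_squared_distance:
  fixes X :: "'a \<Rightarrow> real"
  assumes X: "integrable M X" and X2: "integrable M (\<lambda>w. (X w)\<^sup>2)"
  shows "variance X \<le> expectation (\<lambda>w. (X w - m)\<^sup>2)"
proof -
  have "expectation (\<lambda>w. (X w - m)\<^sup>2) = expectation (\<lambda>w. (X w)\<^sup>2) - 2 * m * expectation X + m\<^sup>2"
    using X X2 by (simp add: power2_diff prob_space algebra_simps)
  moreover have "0 \<le> (expectation X - m)\<^sup>2"
    by simp
  ultimately show ?thesis
    unfolding variance_eq[OF X X2] by (simp add: power2_diff algebra_simps)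
qed

lemma moments_of_perturbation:
  fixes X :: "'a \<Rightarrow> real" and \<nu> :: "nat \<Rightarrow> 'a \<Rightarrow> real" and l \<sigma> :: "nat \<Rightarrow> real"
  assumes X: "integrable M X" and X2: "integrable M (\<lambda>w. (X w)\<^sup>2)"
    and meas: "\<And>n. n \<in> A \<Longrightarrow> \<nu> n \<in> borel_measurable M"
    and sq: "\<And>n. n \<in> A \<Longrightarrow> integrable M (\<lambda>w. (\<nu> n w)\<^sup>2)"
    and mean: "\<And>n. n \<in> A \<Longrightarrow> expectation (\<nu> n) = 0"
    and var: "\<And>n. n \<in> A \<Longrightarrow> expectation (\<lambda>w. (\<nu> n w)\<^sup>2) \<le> s2"
    and K: "0 \<le> K1" "0 \<le> K2"
    and lin: "\<And>w. w \<in> space M \<Longrightarrow> \<bar>X w - m + (\<Sum>n\<in>A. l n * \<nu> n w)\<bar> \<le> K1 * (\<Sum>n\<in>A. (\<nu> n w)\<^sup>2)"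
    and quad: "\<And>w. w \<in> space M \<Longrightarrow> (X w - m)\<^sup>2 \<le> K2 * (\<Sum>n\<in>A. (\<nu> n w)\<^sup>2)"
  shows "\<bar>expectation X - m\<bar> \<le> K1 * (real (card A) * s2)"
    and "variance X \<le> K2 * (real (card A) * s2)"
proof -
  have int: "integrable M (\<nu> n)" if "n \<in> A" for n
    using square_integrable_imp_integrable[OF meas[OF that] sq[OF that]] .
  have intQ: "integrable M (\<lambda>w. \<Sum>n\<in>A. (\<nu> n w)\<^sup>2)" and intL: "integrable M (\<lambda>w. \<Sum>n\<in>A. l n * \<nu> n w)"
    using sq int by (auto intro!: Bochner_Integration.integrable_sum)
  have Q: "expectation (\<lambda>w. \<Sum>n\<in>A. (\<nu> n w)\<^sup>2) \<le> real (card A) * s2"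
    using sq var sum_mono[of A "\<lambda>n. expectation (\<lambda>w. (\<nu> n w)\<^sup>2)" "\<lambda>_. s2"]
    by (simp add: Bochner_Integration.integral_sum)
  \<comment> \<open>The \<nu> are centred and the coefficients \<open>l\<close> deterministic, so
    the linear term can be added without changing the expectation.\<close>
  have "expectation X - m = expectation (\<lambda>w. X w - m + (\<Sum>n\<in>A. l n * \<nu> n w))"
    using X intL int by (simp add: prob_space Bochner_Integration.integral_sum mean)
  also have "\<bar>\<dots>\<bar> \<le> expectation (\<lambda>w. \<bar>X w - m + (\<Sum>n\<in>A. l n * \<nu> n w)\<bar>)"
    by (rule integral_abs_bound)
  also have "\<dots> \<le> expectation (\<lambda>w. K1 * (\<Sum>n\<in>A. (\<nu> n w)\<^sup>2))"
    using X intL intQ lin by (intro integral_mono) auto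
  also have "\<dots> \<le> K1 * (real (card A) * s2)"
    using Q K by (simp add: mult_left_mono)
  finally show "\<bar>expectation X - m\<bar> \<le> K1 * (real (card A) * s2)" .
  have "integrable M (\<lambda>w. (X w - m)\<^sup>2)"
    using X X2 by (simp add: power2_diff)
  hence "expectation (\<lambda>w. (X w - m)\<^sup>2) \<le> expectation (\<lambda>w. K2 * (\<Sum>n\<in>A. (\<nu> n w)\<^sup>2))"
    using intQ quad by (intro integral_mono) auto
  also have "\<dots> \<le> K2 * (real (card A) * s2)"
    using Q K by (simp add: mult_left_mono)
  finally show "variance X \<le> K2 * (real (card A) * s2)"
    using variance_le_squared_distance[OF X X2, of m] by linarith
qed

end

section \<open>Application to the image\<close>

lemma Phi_continuous: "continuous_on UNIV (Phi M \<omega>)"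
  unfolding Phi_def by (intro continuous_intros)

text \<open>Compare third coordinates: the receivers fly at height \<open>H\<close> above the
  imaging plane. This keeps all distances away from zero.\<close>

lemma flight_position_dist:
  assumes "H > 0"
  shows "H \<le> dist (flight_position a R H N n) (u, v, 0)"
proof -
  have "H = dist (snd (snd (flight_position a R H N n))) (snd (snd (u, v, 0 :: real)))"
    using assms by (simp add: flight_position_def dist_real_def)
  also have "\<dots> \<le> dist (flight_position a R H N n) (u, v, 0)"
    by (intro order.trans[OF dist_snd_le] dist_snd_le)
  finally show ?thesis .
qed

theorem theorem6p1:
  fixes a R H c \<omega>0 B x0 y0 :: real and M N :: nat and \<rho>0 :: complex
    and L :: real and p0 :: point and x :: "nat \<Rightarrow> point" and \<omega> :: "nat \<Rightarrow> real"
  assumes "a > 0" and "R > 0" and "H > 0" and "N \<ge> 2" and "c > 0"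
    and "M \<ge> 2" and "B > 0" and "\<omega>0 > 0"
    and "\<rho>0 \<noteq> 0"
    and L_def: "L = sqrt (R\<^sup>2 + H\<^sup>2)"
    and p0_def: "p0 = (x0, y0, 0)"
    and x_def: "x = flight_position a R H N"
    and \<omega>_def: "\<omega> = frequency \<omega>0 B M"
    and L_largest: "a \<le> L" "norm p0 \<le> L"
  shows "\<exists>C > 0. \<exists>\<delta> > 0. \<exists>r > 0.
    \<forall>(P :: 'w measure) \<nu> \<sigma> \<sigma>2 \<epsilon> U s V U0 s0 V0.
      (let d = (\<lambda>w n. born_data \<omega> \<rho>0 p0 (x n) (travel_time c (x n) p0 - \<nu> n w));
           d0 = (\<lambda>n. born_data \<omega> \<rho>0 p0 (x n) (travel_time c (x n) p0))
       in
         prob_space P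
         \<and> (\<forall>n\<in>{1..N}. \<nu> n \<in> borel_measurable P \<and> integrable P (\<lambda>w. (\<nu> n w)\<^sup>2)
              \<and> prob_space.expectation P (\<nu> n) = 0
              \<and> prob_space.expectation P (\<lambda>w. (\<nu> n w)\<^sup>2) = (\<sigma> n)\<^sup>2)
         \<and> \<sigma>2 = Max ((\<lambda>n. (\<sigma> n)\<^sup>2) ` {1..N})
         \<and> 0 < \<epsilon> \<and> \<epsilon> < 1 \<and> \<sigma>2 / \<epsilon> < \<delta>
         \<and> (\<forall>n\<in>{1..N}. \<forall>w\<in>space P.
              is_svd M (prony_matrix M (d w n)) (U w n) (s w n) (V w n)
              \<and> signal_distinguished M (s w n))
         \<and> (\<forall>n\<in>{1..N}.
              is_svd M (prony_matrix M (d0 n)) (U0 n) (s0 n) (V0 n)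
              \<and> signal_distinguished M (s0 n))
         \<longrightarrow>
         (\<forall>u v. dist (u, v, 0) p0 < r \<longrightarrow>
            (let image = (\<lambda>w. 1 / F_image N M \<omega> c x \<epsilon> (U w) (s w) (u, v, 0));
                 image0 = 1 / F_image N M \<omega> c x \<epsilon> U0 s0 (u, v, 0)
             in
               integrable P image \<and> integrable P (\<lambda>w. (image w)\<^sup>2)
               \<and> \<bar>prob_space.expectation P image - image0\<bar> \<le> C * (\<sigma>2 / \<epsilon>)
               \<and> prob_space.variance P image \<le> C * (\<sigma>2 / \<epsilon>))))"
proof -
  have M1: "M \<ge> 1"
    using \<open>M \<ge> 2\<close> by simp
  define h where "h t = 1 - (cmod (Phi M \<omega> t))\<^sup>2" for t
  have h0: "0 \<le> h t" for t
    using Phi_norm_squared_le_1[OF M1] by (simp add: h_def)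
  obtain \<kappa> b where \<kappa>: "\<kappa> > 0" and hlin: "\<And>t v. \<bar>h (t + v) - h t - b t * v\<bar> \<le> \<kappa> * v\<^sup>2"
    and hlip: "\<And>t v. (h (t + v) - h t)\<^sup>2 \<le> \<kappa> * v\<^sup>2 * (h (t + v) + h t)"
    unfolding h_def using Phi_bounds[OF M1, of \<omega>] by metis
  have [measurable]: "h \<in> borel_measurable borel"
    unfolding h_def
    by (intro borel_measurable_continuous_onI continuous_intros continuous_on_subset[OF Phi_continuous]) auto
  \<comment> \<open>The lower bound for the total weight: \<open>H / (H + 1)\<close> bounds the
    ratios of target distance to search distance when the search point is within 1 of the
    target.\<close>
  define \<mu> where "\<mu> = (H / (H + 1))\<^sup>2 / cmod \<rho>0"
  have \<mu>: "\<mu> > 0"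
    using \<open>H > 0\<close> \<open>\<rho>0 \<noteq> 0\<close> by (simp add: \<mu>_def)
  \<comment> \<open>The sum of both constants of \<open>reciprocal_perturbation\<close> without
    \<eta>, so that one \<open>C\<close> serves mean and variance. The factor \<open>N\<close>
    counts the second moments, each at most \<sigma>2.\<close>
  define C where "C = (3 * \<kappa> / \<mu> + 2 * \<kappa> / \<mu>\<^sup>2) * real N"
  have C: "C > 0"
    using \<kappa> \<mu> \<open>N \<ge> 2\<close> by (simp add: C_def add_pos_pos)
  have dist: "H \<le> dist (x n) (u, v, 0)" for n u v
    unfolding x_def by (rule flight_position_dist[OF \<open>H > 0\<close>])
  have one: "(0 :: real) < 1"
    by simp
  show ?thesis
  \<comment> \<open>The witnesses for \<delta> and \<open>r\<close> are both 1; the radius is the 1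
    in \<open>H + 1\<close>.\<close>
  proof (unfold Let_def, rule exI[of _ C], rule conjI[OF C], rule exI[of _ "1 :: real"], rule conjI[OF one],
      rule exI[of _ "1 :: real"], rule conjI[OF one], intro allI impI)
    fix P :: "'w measure" and \<nu> :: "nat \<Rightarrow> 'w \<Rightarrow> real" and \<sigma> :: "nat \<Rightarrow> real" and \<sigma>2 \<epsilon> u v :: real
      and U V :: "'w \<Rightarrow> nat \<Rightarrow> complex mat" and s :: "'w \<Rightarrow> nat \<Rightarrow> nat \<Rightarrow> real"
      and U0 V0 :: "nat \<Rightarrow> complex mat" and s0 :: "nat \<Rightarrow> nat \<Rightarrow> real"
    assume asm: "prob_space P
         \<and> (\<forall>n\<in>{1..N}. \<nu> n \<in> borel_measurable P \<and> integrable P (\<lambda>w. (\<nu> n w)\<^sup>2)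
              \<and> prob_space.expectation P (\<nu> n) = 0
              \<and> prob_space.expectation P (\<lambda>w. (\<nu> n w)\<^sup>2) = (\<sigma> n)\<^sup>2)
         \<and> \<sigma>2 = Max ((\<lambda>n. (\<sigma> n)\<^sup>2) ` {1..N})
         \<and> 0 < \<epsilon> \<and> \<epsilon> < 1 \<and> \<sigma>2 / \<epsilon> < 1
         \<and> (\<forall>n\<in>{1..N}. \<forall>w\<in>space P.
              is_svd M (prony_matrix M (born_data \<omega> \<rho>0 p0 (x n) (travel_time c (x n) p0 - \<nu> n w)))
                (U w n) (s w n) (V w n)
              \<and> signal_distinguished M (s w n))
         \<and> (\<forall>n\<in>{1..N}.
              is_svd M (prony_matrix M (born_data \<omega> \<rho>0 p0 (x n) (travel_time c (x n) p0)))
                (U0 n) (s0 n) (V0 n)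
              \<and> signal_distinguished M (s0 n))"
      and near: "dist (u, v, 0) p0 < 1"
    interpret prob_space P
      using asm by blast
    have \<nu>: "\<nu> n \<in> borel_measurable P" "integrable P (\<lambda>w. (\<nu> n w)\<^sup>2)" "expectation (\<nu> n) = 0"
      "expectation (\<lambda>w. (\<nu> n w)\<^sup>2) = (\<sigma> n)\<^sup>2" if "n \<in> {1..N}" for n
      using asm that by blast+
    have \<epsilon>: "0 < \<epsilon>" "\<epsilon> < 1"
      using asm by blast+
    have \<sigma>2: "(\<sigma> n)\<^sup>2 \<le> \<sigma>2" if "n \<in> {1..N}" for n
      using asm that by auto
    have \<sigma>2_nonneg: "0 \<le> \<sigma>2"
      using order.trans[OF zero_le_power2 \<sigma>2[of 1]] \<open>N \<ge> 2\<close> by auto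
    define y :: point where "y = (u, v, 0)"
    define \<eta> where "\<eta> = 1 / \<epsilon> - 1"
    have \<eta>: "0 \<le> \<eta>" "\<eta> \<le> 1 / \<epsilon>"
      using \<epsilon> by (simp_all add: \<eta>_def)
    define t where "t n = 2 * (dist (x n) y - dist (x n) p0) / c" for n
    define wt where "wt n = 1 / cmod \<rho>0 * (1 / real N) * ((dist (x n) p0)\<^sup>2 / (dist (x n) y)\<^sup>2)" for n
    have wt: "0 \<le> wt n" for n
      by (simp add: wt_def)
    have \<mu>_le: "\<mu> \<le> (\<Sum>n = 1..N. wt n)"
    proof -
      have "\<mu> / real N \<le> wt n" for n
      proof -
        let ?d = "dist (x n) p0"
        have d: "H \<le> ?d" "H \<le> dist (x n) y"
          using dist by (simp_all add: p0_def y_def)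
        have "dist (x n) y \<le> ?d + 1"
          using dist_triangle[of "x n" y p0] near by (simp add: y_def dist_commute)
        hence "?d / (?d + 1) \<le> ?d / dist (x n) y"
          using d \<open>H > 0\<close> by (intro divide_left_mono mult_pos_pos) auto
        \<comment> \<open>The map from \<open>d\<close> to \<open>d / (d + 1)\<close> is increasing,
          and \<open>d\<close> is at least \<open>H\<close>.\<close>
        moreover have "H / (H + 1) \<le> ?d / (?d + 1)"
          using d \<open>H > 0\<close> by (simp add: field_simps)
        ultimately have "(H / (H + 1))\<^sup>2 \<le> (?d / dist (x n) y)\<^sup>2"
          using \<open>H > 0\<close> by (intro power_mono) auto
        hence "1 / cmod \<rho>0 * (1 / real N) * (H / (H + 1))\<^sup>2
            \<le> 1 / cmod \<rho>0 * (1 / real N) * (?d / dist (x n) y)\<^sup>2"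
          by (intro mult_left_mono) auto
        thus ?thesis
          by (simp add: wt_def \<mu>_def power_divide mult_ac)
      qed
      hence "(\<Sum>n = 1..N. \<mu> / real N) \<le> (\<Sum>n = 1..N. wt n)"
        by (intro sum_mono)
      thus ?thesis
        using \<open>N \<ge> 2\<close> by simp
    qed
    \<comment> \<open>A function of a deterministic delay vector, so that one closed form covers
      each realisation of \<nu> as well as the homogeneous medium, \<open>z = 0\<close>.\<close>
    define G where "G z = (\<Sum>n = 1..N. wt n * (1 + \<eta> * h (t n + z n)))" for z
    have closed: "F_image N M \<omega> c x \<epsilon> Ua sa y = G z"
      if "\<And>n. n \<in> {1..N} \<Longrightarrow>
            is_svd M (prony_matrix M (born_data \<omega> \<rho>0 p0 (x n) (travel_time c (x n) p0 - z n)))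
              (Ua n) (sa n) (Va n) \<and> signal_distinguished M (sa n)" for Ua sa Va z
    proof -
      have "x n \<noteq> p0" "x n \<noteq> y" for n
        using dist[of n x0 y0] dist[of n u v] \<open>H > 0\<close> by (auto simp: p0_def y_def)
      hence "F_image N M \<omega> c x \<epsilon> Ua sa y = 1 / cmod \<rho>0 * (1 / real N) * (\<Sum>n = 1..N.
          (1 / \<epsilon> - (1 / \<epsilon> - 1) * (cmod (Phi M \<omega> (t n + z n)))\<^sup>2)
          * ((dist (x n) p0)\<^sup>2 / (dist (x n) y)\<^sup>2))"
        unfolding t_def using that
        by (intro F_image_closed_form[OF \<open>M \<ge> 2\<close> \<open>\<rho>0 \<noteq> 0\<close> \<epsilon>(1) \<omega>_def]) auto
      also have "\<dots> = G z"
      proof -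
        have eq: "k - (k - 1) * q = 1 + (k - 1) * (1 - q)" for k q :: real
          by (simp add: algebra_simps)
        show ?thesis
          unfolding G_def wt_def h_def \<eta>_def eq sum_distrib_left by (simp only: mult_ac)
      qed
      finally show ?thesis .
    qed
    have image: "F_image N M \<omega> c x \<epsilon> (U w) (s w) y = G (\<lambda>n. \<nu> n w)" if "w \<in> space P" for w
      using asm that by (intro closed[of "\<lambda>n. \<nu> n w" "U w" "s w" "V w"]) blast
    have image0: "F_image N M \<omega> c x \<epsilon> U0 s0 y = G (\<lambda>_. 0)"
      using asm by (intro closed[of "\<lambda>_. 0" U0 s0 V0]) simp
    \<comment> \<open>The singular vectors \<open>U w\<close> may be chosen without any
      measurability in \<open>w\<close>. The closed form is free of them and agrees with the image
      on \<open>space P\<close>, so measurability is read off from \<open>h\<close>.\<close>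
    define X where "X w = 1 / G (\<lambda>n. \<nu> n w)" for w
    have G: "\<mu> \<le> G z" for z
    proof -
      have "(\<Sum>n = 1..N. wt n) \<le> G z"
        unfolding G_def
      proof (rule sum_mono)
        show "wt n \<le> wt n * (1 + \<eta> * h (t n + z n))" for n
          using mult_left_mono[of 1 "1 + \<eta> * h (t n + z n)" "wt n"] wt h0 \<eta> by simp
      qed
      thus ?thesis
        using \<mu>_le by linarith
    qed
    have meas: "X \<in> borel_measurable P"
      unfolding X_def G_def using \<nu>(1) by measurable
    \<comment> \<open>The lower bound \<mu> on \<open>G\<close> bounds the image, whence both
      integrability claims.\<close>
    have X_le: "\<bar>X w\<bar> \<le> 1 / \<mu>" for w
      using G[of "\<lambda>n. \<nu> n w"] \<mu> by (simp add: X_def frac_le)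
    have X: "integrable P X"
      using X_le by (intro integrable_const_bound[of _ "1 / \<mu>"] meas) auto
    have X2: "integrable P (\<lambda>w. (X w)\<^sup>2)"
    proof (rule integrable_const_bound)
      show "AE w in P. norm ((X w)\<^sup>2) \<le> (1 / \<mu>)\<^sup>2"
        using power_mono[OF X_le abs_ge_zero, of _ 2] by simp
    qed (use meas in measurable)
    have K: "0 \<le> 3 * \<eta> * \<kappa> / \<mu>" "0 \<le> 2 * \<eta> * \<kappa> / \<mu>\<^sup>2"
      using \<eta> \<kappa> \<mu> by auto
    define l where "l n = \<eta> * wt n * b (t n) / (\<Sum>n = 1..N. wt n * (1 + \<eta> * h (t n)))\<^sup>2" for n
    note pert = reciprocal_perturbation[of "{1..N}" wt, OF wt \<mu> \<mu>_le \<eta>(1) finite_atLeastAtMost h0 \<kappa> hlin hlip]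
    have lin: "\<bar>X w - 1 / G (\<lambda>_. 0) + (\<Sum>n = 1..N. l n * \<nu> n w)\<bar>
        \<le> 3 * \<eta> * \<kappa> / \<mu> * (\<Sum>n = 1..N. (\<nu> n w)\<^sup>2)" for w
      unfolding X_def G_def l_def add_0_right by (rule pert(1))
    have quad: "(X w - 1 / G (\<lambda>_. 0))\<^sup>2 \<le> 2 * \<eta> * \<kappa> / \<mu>\<^sup>2 * (\<Sum>n = 1..N. (\<nu> n w)\<^sup>2)" for w
      unfolding X_def G_def add_0_right by (rule pert(2))
    have var_le: "expectation (\<lambda>w. (\<nu> n w)\<^sup>2) \<le> \<sigma>2" if "n \<in> {1..N}" for n
      using \<nu>(4)[OF that] \<sigma>2[OF that] by simp
    note moments = moments_of_perturbation[of X "{1..N}" \<nu> \<sigma>2, OF X X2 \<nu>(1-3) var_le K lin quad]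
    \<comment> \<open>Used with \<open>k = 3\<close>, \<open>m = \<mu>\<close> for the mean and with
      \<open>k = 2\<close>, \<open>m = \<mu>^2\<close> for the variance. The estimate of \<eta> by
      \<open>1 / \<epsilon>\<close> yields the order \<open>\<sigma>2 / \<epsilon>\<close>.\<close>
    have cmp: "k * \<eta> * \<kappa> / m * (real (card {1..N}) * \<sigma>2) \<le> C * (\<sigma>2 / \<epsilon>)"
      if "k * \<kappa> / m * real N \<le> C" "0 \<le> k" "0 < m" for k m
    proof -
      have "k * \<eta> * \<kappa> / m * (real (card {1..N}) * \<sigma>2) = k * \<kappa> / m * real N * (\<sigma>2 * \<eta>)"
        by simp
      also have "\<dots> \<le> C * (\<sigma>2 * (1 / \<epsilon>))"
        using that C \<eta> \<sigma>2_nonneg by (intro mult_mono) auto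
      finally show ?thesis
        by simp
    qed
    have bounds: "\<bar>expectation X - 1 / G (\<lambda>_. 0)\<bar> \<le> C * (\<sigma>2 / \<epsilon>)" "variance X \<le> C * (\<sigma>2 / \<epsilon>)"
      using \<kappa> \<mu> by (intro order.trans[OF moments(1) cmp] order.trans[OF moments(2) cmp];
          simp add: C_def distrib_right)+
    have eq: "1 / F_image N M \<omega> c x \<epsilon> (U w) (s w) (u, v, 0) = X w" if "w \<in> space P" for w
      using image[OF that] by (simp add: X_def y_def)
    have eq0: "F_image N M \<omega> c x \<epsilon> U0 s0 (u, v, 0) = G (\<lambda>_. 0)"
      using image0 by (simp add: y_def)
    let ?I = "\<lambda>w. 1 / F_image N M \<omega> c x \<epsilon> (U w) (s w) (u, v, 0)"
    have int1: "integrable P ?I" and int2: "integrable P (\<lambda>w. (?I w)\<^sup>2)"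
      using Bochner_Integration.integrable_cong[of P P ?I X]
        Bochner_Integration.integrable_cong[of P P "\<lambda>w. (?I w)\<^sup>2" "\<lambda>w. (X w)\<^sup>2"] eq X X2 by simp_all
    have exp: "expectation ?I = expectation X"
      using eq by (intro Bochner_Integration.integral_cong refl)
    have var: "variance ?I = variance X"
      unfolding exp using eq by (intro Bochner_Integration.integral_cong refl) (simp only:)
    show "integrable P ?I \<and> integrable P (\<lambda>w. (?I w)\<^sup>2)
        \<and> \<bar>expectation ?I - 1 / F_image N M \<omega> c x \<epsilon> U0 s0 (u, v, 0)\<bar> \<le> C * (\<sigma>2 / \<epsilon>)
        \<and> variance ?I \<le> C * (\<sigma>2 / \<epsilon>)"
      unfolding var unfolding exp eq0 using int1 int2 bounds by blast
  qed
qed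

end
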